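(* Let $u_1,u_2\in\mathbb{R}^p$, the matrix $S$ and the asymptotic mean-square errors be as defined in the context, for SPSA and RDSA run with the same gain sequences. If $$2u_1^TSu_1+u_1^TSu_2\ge 0,$$ then SPSA with Bernoulli perturbation (components $\Delta_{ki}$ i.i.d. equal to $\pm1$ with probability $1/2$ each) has a smaller asymptotic mean-square error than RDSA with Gaussian perturbation (components $\pi_{ki}$ i.i.d. $N(0,1)$): $\mathrm{MSE}_{\mathrm{SP}}<\mathrm{MSE}_{\mathrm{RD}}$.
   Context: $L:\mathbb{R}^p\to\mathbb{R}$ is a smooth loss function with unique minimum $\theta^*$, Hessian $H$, and third partial derivatives $L'''_{ijk}$. Noisy measurements $y(\theta)=L(\theta)+\text{noise}$ are available. Both algorithms iterate $\hat\theta_{k+1}=\hat\theta_k-a_k\hat g_k(\hat\theta_k)$ with gains $a_k=a/(k+1)^\alpha$, $c_k=c/(k+1)^\gamma$, where $a,c>0$, $0<\alpha\le1$, $\gamma\ge\alpha/6$, $\beta=\alpha-2\gamma>0$. SPSA (simultaneous-perturbation stochastic approximation) uses the estimate $\hat g_k$ with $i$th component $\frac{y(\hat\theta_k+c_k\Delta_k)-y(\hat\theta_k-c_k\Delta_k)}{2c_k\Delta_{ki}}$ and RDSA (random-direction stochastic approximation) uses $\hat g_k=\frac{y(\hat\theta_k+c_k\pi_k)-y(\hat\theta_k-c_k\pi_k)}{2c_k}\pi_k$, with $\Delta_k,\pi_k\in\mathbb{R}^p$ random perturbation vectors. $\sigma^2$ is the limit as $k\to\infty$ of the second moment of the difference of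 the two measurement noises at iteration $k$. Let $\lambda_1,\dots,\lambda_p$ be the eigenvalues of $aH(\theta^* )$, all positive; $\beta_+=\beta$ if $\alpha=1$ (in which case $\beta<2\min_i\lambda_i$ is assumed) and $\beta_+=0$ if $\alpha<1$. Notation: $\phi=E(\pi_{ki}^4)$, $\upsilon=E(\pi_{ki}^2\pi_{km}^2)$ ($i\ne m$), $\xi^2=E(\Delta_{ki}^2)$, $\rho^2=E(\Delta_{ki}^{-2})$; $$u_1=\tfrac{ac^2}{6}\left[L'''_{111}(\theta^* ),\dots,L'''_{ppp}(\theta^* )\right]^T,\quad u_2=\tfrac{ac^2}{6}\Big[3\sum_{j\ne1}L'''_{jj1}(\theta^* ),\dots,3\sum_{j\ne p}L'''_{jjp}(\theta^* )\Big]^T,$$ $$S=\left(aH(\theta^* )-\tfrac{\beta_+}{2}I\right)^{-2},\qquad D=\frac{a^2\sigma^2}{4c^2}\sum_{i=1}^p\frac{1}{2\lambda_i-\beta_+}.$$ The scaled errors $k^{\beta/2}(\hat\theta_k-\theta^* )$ are asymptotically normal with mean $\mu$ and covariance $PMP^T$ ($P$ orthogonal), and the asymptotic mean-square error is $\mathrm{MSE}=\mu^T\mu+\mathrm{tr}(M)$. Here $\mathrm{tr}(M)=D$ for RDSA and $\rho^2D$ for SPSA; $\mu=0$ if $3\gamma-\alpha/2>0$; and if $3\gamma-\alpha/2=0$ then $\mu=(aH(\theta^* )-\frac{\beta_+}{2}I)^{-1}T$ with $T=-(\phi u_1+\upsilon u_2)$ for RDSA and $T=-\xi^2(u_1+u_2)$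 for SPSA. Thus, when $3\gamma-\alpha/2=0$, $$\mathrm{MSE}_{\mathrm{RD}}=(\phi u_1+\upsilon u_2)^TS(\phi u_1+\upsilon u_2)+D,\qquad \mathrm{MSE}_{\mathrm{SP}}=\xi^4(u_1+u_2)^TS(u_1+u_2)+\rho^2D.$$ For Bernoulli SPSA, $\xi^2=\rho^2=1$; for Gaussian RDSA, $\phi=3$, $\upsilon=1$.
   Formalization: Since the MSEs are equal when 2u₁ᵀSu₁+u₁ᵀSu₂=0 (e.g. quadratic L) or 3γ−α/2>0, the strict inequality is replaced by MSE_SP ≤ MSE_RD, with strict inequality exactly when 3γ−α/2=0 and 2u₁ᵀSu₁+u₁ᵀSu₂>0. *)

theory Defs
  imports "HOL-Probability.Probability"
begin

definition partial :: "'p \<Rightarrow> (real^'p::finite \<Rightarrow> real) \<Rightarrow> real^'p \<Rightarrow> real" where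
  "partial i f x = deriv (\<lambda>t. f (x + t *\<^sub>R axis i 1)) 0"

primrec C_k :: "nat \<Rightarrow> (real^'p::finite \<Rightarrow> real) \<Rightarrow> bool" where
  "C_k 0 f \<longleftrightarrow> continuous_on UNIV f"
| "C_k (Suc n) f \<longleftrightarrow> f differentiable_on UNIV \<and> (\<forall>i. C_k n (partial i f))"

definition hessian :: "(real^'p::finite \<Rightarrow> real) \<Rightarrow> real^'p \<Rightarrow> real^'p^'p" where
  "hessian L x = (\<chi> i j. partial i (partial j L) x)"

definition third :: "(real^'p::finite \<Rightarrow> real) \<Rightarrow> real^'p \<Rightarrow> 'p \<Rightarrow> 'p \<Rightarrow> 'p \<Rightarrow> real" where
  "third L x i j k = partial i (partial j (partial k L)) x"

definition gain :: "real \<Rightarrow> real \<Rightarrow> nat \<Rightarrow> real" where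
  "gain a e k = a / real (k + 1) powr e"

definition \<beta>_of :: "real \<Rightarrow> real \<Rightarrow> real" where
  "\<beta>_of \<alpha> \<gamma> = \<alpha> - 2 * \<gamma>"

definition \<beta>_plus :: "real \<Rightarrow> real \<Rightarrow> real" where
  "\<beta>_plus \<alpha> \<gamma> = (if \<alpha> = 1 then \<beta>_of \<alpha> \<gamma> else 0)"

definition diag :: "('p::finite \<Rightarrow> real) \<Rightarrow> real^'p^'p" where
  "diag v = (\<chi> i j. if i = j then v i else 0)"

text \<open>Smoothness of the loss is only required up to the third partial derivatives.
  The eigenvalues of \<open>a H(\<theta>*)\<close>, listed with multiplicity, are the entries of \<open>eig\<close>;
  the columns of the orthogonal matrix \<open>P\<close> are corresponding eigenvectors.\<close>

locale sa_problem =
  fixes L :: "real^'p::finite \<Rightarrow> real" and \<theta>opt :: "real^'p"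
    and a c \<alpha> \<gamma> :: real and P :: "real^'p^'p" and eig :: "'p \<Rightarrow> real"
  assumes smooth: "C_k 3 L"
    and unique_minimum: "\<And>\<theta>. \<theta> \<noteq> \<theta>opt \<Longrightarrow> L \<theta>opt < L \<theta>"
    and a_pos: "0 < a" and c_pos: "0 < c"
    and \<alpha>_pos: "0 < \<alpha>" and \<alpha>_le_1: "\<alpha> \<le> 1"
    and \<gamma>_ge: "\<alpha> / 6 \<le> \<gamma>"
    and \<beta>_pos: "0 < \<beta>_of \<alpha> \<gamma>"
    and P_orthogonal: "orthogonal_matrix P"
    and eigenvalues: "transpose P ** (a *\<^sub>R hessian L \<theta>opt) ** P = diag eig"
    and eig_pos: "\<And>i. 0 < eig i"
    and \<beta>_less: "\<And>i. \<alpha> = 1 \<Longrightarrow> \<beta>_of \<alpha> \<gamma> < 2 * eig i"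

text \<open>Gradient estimates: \<open>c\<close> is the current gain, \<open>d\<close> the perturbation vector,
  \<open>yp\<close> and \<open>ym\<close> the measurements at \<open>\<theta> + c d\<close> and \<open>\<theta> - c d\<close>.\<close>

definition spsa_estimate :: "real \<Rightarrow> real^'p::finite \<Rightarrow> real \<Rightarrow> real \<Rightarrow> real^'p" where
  "spsa_estimate c d yp ym = (\<chi> i. (yp - ym) / (2 * c * d $ i))"

definition rdsa_estimate :: "real \<Rightarrow> real^'p::finite \<Rightarrow> real \<Rightarrow> real \<Rightarrow> real^'p" where
  "rdsa_estimate c d yp ym = ((yp - ym) / (2 * c)) *\<^sub>R d"

text \<open>A run on a probability space \<open>M\<close>: iterates \<open>\<theta>\<close>, perturbations \<open>d\<close>, and measurement
  noises \<open>\<epsilon>p\<close>, \<open>\<epsilon>m\<close> at the two points of each iteration.\<close>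

locale sa_run = prob_space M for M :: "'w measure" +
  fixes est :: "real \<Rightarrow> real^'p::finite \<Rightarrow> real \<Rightarrow> real \<Rightarrow> real^'p"
    and L :: "real^'p \<Rightarrow> real" and a c \<alpha> \<gamma> :: real
    and \<theta> d :: "nat \<Rightarrow> 'w \<Rightarrow> real^'p" and \<epsilon>p \<epsilon>m :: "nat \<Rightarrow> 'w \<Rightarrow> real" and \<sigma> :: real
  assumes \<theta>_measurable: "\<And>k. \<theta> k \<in> borel_measurable M"
    and d_measurable: "\<And>k. d k \<in> borel_measurable M"
    and \<epsilon>p_measurable: "\<And>k. \<epsilon>p k \<in> borel_measurable M"
    and \<epsilon>m_measurable: "\<And>k. \<epsilon>m k \<in> borel_measurable M"
    and iteration: "\<And>k \<omega>. \<omega> \<in> space M \<Longrightarrow>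
      \<theta> (Suc k) \<omega> = \<theta> k \<omega> - gain a \<alpha> k *\<^sub>R
        est (gain c \<gamma> k) (d k \<omega>)
          (L (\<theta> k \<omega> + gain c \<gamma> k *\<^sub>R d k \<omega>) + \<epsilon>p k \<omega>)
          (L (\<theta> k \<omega> - gain c \<gamma> k *\<^sub>R d k \<omega>) + \<epsilon>m k \<omega>)"
    and noise_square_integrable: "\<And>k. integrable M (\<lambda>\<omega>. (\<epsilon>p k \<omega> - \<epsilon>m k \<omega>)\<^sup>2)"
    and noise_limit: "(\<lambda>k. expectation (\<lambda>\<omega>. (\<epsilon>p k \<omega> - \<epsilon>m k \<omega>)\<^sup>2)) \<longlonglongrightarrow> \<sigma>\<^sup>2"

definition iid_components ::
    "'w measure \<Rightarrow> (nat \<Rightarrow> 'w \<Rightarrow> real^'p::finite) \<Rightarrow> real measure \<Rightarrow> bool" where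
  "iid_components M d \<nu> \<longleftrightarrow>
     prob_space.indep_vars M (\<lambda>_. borel) (\<lambda>(k, i) \<omega>. d k \<omega> $ i) UNIV \<and>
     (\<forall>k i. distr M borel (\<lambda>\<omega>. d k \<omega> $ i) = \<nu>)"

definition symmetric_bernoulli :: "real measure" where
  "symmetric_bernoulli = distr (measure_pmf (pmf_of_set {-1, 1})) borel (\<lambda>x. x)"

definition multivariate_normal :: "(real^'p::finite) measure \<Rightarrow> real^'p \<Rightarrow> real^'p^'p \<Rightarrow> bool" where
  \<comment> \<open>by the characteristic function, so that singular covariances are allowed\<close>
  "multivariate_normal N \<mu> \<Sigma> \<longleftrightarrow> prob_space N \<and> sets N = sets borel \<and>
     (\<forall>t. (CLINT x|N. iexp (t \<bullet> x)) =
        exp (\<i> * complex_of_real (t \<bullet> \<mu>) - complex_of_real (t \<bullet> (\<Sigma> *v t)) / 2))"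

definition asymptotically_normal ::
    "'w measure \<Rightarrow> (nat \<Rightarrow> 'w \<Rightarrow> real^'p::finite) \<Rightarrow> real^'p \<Rightarrow> real^'p^'p \<Rightarrow> bool" where
  "asymptotically_normal M X \<mu> \<Sigma> \<longleftrightarrow> (\<forall>k. X k \<in> borel_measurable M) \<and>
     (\<exists>N. multivariate_normal N \<mu> \<Sigma> \<and>
        (\<forall>f::real^'p \<Rightarrow> real. continuous_on UNIV f \<longrightarrow> bounded (range f) \<longrightarrow>
           (\<lambda>k. LINT \<omega>|M. f (X k \<omega>)) \<longlonglongrightarrow> (LINT x|N. f x)))"

definition scaled_error ::
    "real \<Rightarrow> real^'p::finite \<Rightarrow> (nat \<Rightarrow> 'w \<Rightarrow> real^'p) \<Rightarrow> nat \<Rightarrow> 'w \<Rightarrow> real^'p" where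
  "scaled_error \<beta> \<theta>opt \<theta> k \<omega> = (real k powr (\<beta> / 2)) *\<^sub>R (\<theta> k \<omega> - \<theta>opt)"

definition u_pure :: "(real^'p::finite \<Rightarrow> real) \<Rightarrow> real^'p \<Rightarrow> real \<Rightarrow> real \<Rightarrow> real^'p" where
  "u_pure L \<theta>opt a c = (a * c\<^sup>2 / 6) *\<^sub>R (\<chi> l. third L \<theta>opt l l l)"

definition u_mixed :: "(real^'p::finite \<Rightarrow> real) \<Rightarrow> real^'p \<Rightarrow> real \<Rightarrow> real \<Rightarrow> real^'p" where
  "u_mixed L \<theta>opt a c = (a * c\<^sup>2 / 6) *\<^sub>R (\<chi> l. 3 * (\<Sum>j\<in>UNIV - {l}. third L \<theta>opt j j l))"

definition shifted_hessian ::
    "(real^'p::finite \<Rightarrow> real) \<Rightarrow> real^'p \<Rightarrow> real \<Rightarrow> real \<Rightarrow> real \<Rightarrow> real^'p^'p" where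
  "shifted_hessian L \<theta>opt a \<alpha> \<gamma> = a *\<^sub>R hessian L \<theta>opt - (\<beta>_plus \<alpha> \<gamma> / 2) *\<^sub>R mat 1"

definition S_matrix ::
    "(real^'p::finite \<Rightarrow> real) \<Rightarrow> real^'p \<Rightarrow> real \<Rightarrow> real \<Rightarrow> real \<Rightarrow> real^'p^'p" where
  "S_matrix L \<theta>opt a \<alpha> \<gamma> =
     matrix_inv (shifted_hessian L \<theta>opt a \<alpha> \<gamma>) ** matrix_inv (shifted_hessian L \<theta>opt a \<alpha> \<gamma>)"

definition asymptotic_mean ::
    "(real^'p::finite \<Rightarrow> real) \<Rightarrow> real^'p \<Rightarrow> real \<Rightarrow> real \<Rightarrow> real \<Rightarrow> real^'p \<Rightarrow> real^'p" where
  "asymptotic_mean L \<theta>opt a \<alpha> \<gamma> T =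
     (if 3 * \<gamma> - \<alpha> / 2 > 0 then 0 else matrix_inv (shifted_hessian L \<theta>opt a \<alpha> \<gamma>) *v T)"

definition rdsa_T ::
    "(real^'p::finite \<Rightarrow> real) \<Rightarrow> real^'p \<Rightarrow> real \<Rightarrow> real \<Rightarrow> real \<Rightarrow> real \<Rightarrow> real^'p" where
  "rdsa_T L \<theta>opt a c \<phi> \<upsilon> = - (\<phi> *\<^sub>R u_pure L \<theta>opt a c + \<upsilon> *\<^sub>R u_mixed L \<theta>opt a c)"

definition spsa_T ::
    "(real^'p::finite \<Rightarrow> real) \<Rightarrow> real^'p \<Rightarrow> real \<Rightarrow> real \<Rightarrow> real \<Rightarrow> real^'p" where
  "spsa_T L \<theta>opt a c \<xi> = - (\<xi>\<^sup>2 *\<^sub>R (u_pure L \<theta>opt a c + u_mixed L \<theta>opt a c))"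

text \<open>The covariance of the limit law in the eigenbasis is \<open>\<kappa>\<close> times the following diagonal
  matrix, with \<open>\<kappa> = 1\<close> for RDSA and \<open>\<kappa> = \<rho>\<^sup>2\<close> for SPSA.\<close>

definition M_matrix ::
    "real \<Rightarrow> real \<Rightarrow> real \<Rightarrow> real \<Rightarrow> real \<Rightarrow> ('p::finite \<Rightarrow> real) \<Rightarrow> real^'p^'p" where
  "M_matrix a c \<alpha> \<gamma> \<sigma> eig =
     diag (\<lambda>i. a\<^sup>2 * \<sigma>\<^sup>2 / (4 * c\<^sup>2) * (1 / (2 * eig i - \<beta>_plus \<alpha> \<gamma>)))"

definition D_const :: "real \<Rightarrow> real \<Rightarrow> real \<Rightarrow> real \<Rightarrow> real \<Rightarrow> ('p::finite \<Rightarrow> real) \<Rightarrow> real" where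
  "D_const a c \<alpha> \<gamma> \<sigma> eig =
     a\<^sup>2 * \<sigma>\<^sup>2 / (4 * c\<^sup>2) * (\<Sum>i\<in>UNIV. 1 / (2 * eig i - \<beta>_plus \<alpha> \<gamma>))"

lemma trace_M_matrix:
  "trace (\<kappa> *\<^sub>R M_matrix a c \<alpha> \<gamma> \<sigma> eig) = \<kappa> * D_const a c \<alpha> \<gamma> \<sigma> eig"
  by (simp add: trace_def M_matrix_def D_const_def diag_def sum_distrib_left mult.assoc)

definition asymptotic_mse :: "real^'p::finite \<Rightarrow> real^'p^'p \<Rightarrow> real" where
  "asymptotic_mse \<mu> M = \<mu> \<bullet> \<mu> + trace M"

end

theory Submission
  imports Defs
begin

text \<open>The traces of the two limit covariances coincide because \<open>\<rho>\<^sup>2 = 1\<close>. When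
  \<open>3\<gamma> - \<alpha>/2 = 0\<close>, the bias vectors are \<open>u\<^sub>1 + u\<^sub>2\<close> and \<open>3u\<^sub>1 + u\<^sub>2\<close> up to sign, so by the
  symmetry of \<open>S\<close> the two mean-square errors differ by
  \<open>4 (2 u\<^sub>1\<^sup>T S u\<^sub>1 + u\<^sub>1\<^sup>T S u\<^sub>2)\<close>; otherwise both biases vanish.\<close>

section \<open>Moments of the perturbation components\<close>

lemma integral_symmetric_bernoulli:
  assumes [measurable]: "f \<in> borel_measurable borel"
  shows "(LINT x|symmetric_bernoulli. f x) = (f (-1) + f 1 :: real) / 2"
proof -
  have "(LINT x|symmetric_bernoulli. f x) = (LINT x|measure_pmf (pmf_of_set {-1, 1}). f x)"
    unfolding symmetric_bernoulli_def by (subst integral_distr) simp_all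
  also have "\<dots> = (f (-1) + f 1) / 2"
    by (subst integral_pmf_of_set) simp_all
  finally show ?thesis .
qed

lemma borel_measurable_vec_nth [measurable (raw)]:
  fixes f :: "'a \<Rightarrow> real^'n::finite"
  assumes "f \<in> borel_measurable M"
  shows "(\<lambda>x. f x $ i) \<in> borel_measurable M"
  by (rule measurable_compose[OF assms])
     (intro borel_measurable_continuous_onI continuous_intros)

lemma iid_components_expectation:
  assumes iid: "iid_components M d \<nu>" and [measurable]: "d k \<in> borel_measurable M"
    and [measurable]: "f \<in> borel_measurable borel"
  shows "(LINT \<omega>|M. f (d k \<omega> $ i)) = (LINT x|\<nu>. (f x :: real))"
proof -
  have "\<nu> = distr M borel (\<lambda>\<omega>. d k \<omega> $ i)"
    using iid by (simp add: iid_components_def)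
  then show ?thesis
    by (simp add: integral_distr)
qed

text \<open>Independence is assumed over all index pairs \<open>(k, i)\<close>; restricting it to
  two coordinates of one iteration factorises the mixed moment. This serves to evaluate
  \<upsilon>.\<close>

lemma iid_components_expectation_mult:
  assumes "prob_space M" and iid: "iid_components M d \<nu>"
    and [measurable]: "d k \<in> borel_measurable M"
    and [measurable]: "f \<in> borel_measurable borel" "g \<in> borel_measurable borel"
    and int: "integrable \<nu> f" "integrable \<nu> g" and "i \<noteq> m"
  shows "(LINT \<omega>|M. f (d k \<omega> $ i) * g (d k \<omega> $ m)) = (LINT x|\<nu>. f x) * (LINT x|\<nu>. (g x :: real))"
proof -
  interpret prob_space M by fact
  have \<nu>: "\<nu> = distr M borel (\<lambda>\<omega>. d k \<omega> $ j)" for j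
    using iid by (simp add: iid_components_def)
  \<comment> \<open>One family indexed by pairs lets the composition rule apply \<open>f\<close> to
    coordinate \<open>i\<close> and \<open>g\<close> to coordinate \<open>m\<close>; the two are
    kept apart by \<open>i \<noteq> m\<close>.\<close>
  let ?h = "\<lambda>p. if p = (k, i) then f else g"
  have "indep_vars (\<lambda>_. borel) (\<lambda>(k, i) \<omega>. d k \<omega> $ i) UNIV"
    using iid by (simp add: iid_components_def)
  then have "indep_vars (\<lambda>_. borel) (\<lambda>(k, i) \<omega>. d k \<omega> $ i) {(k, i), (k, m)}"
    by (rule indep_vars_subset) simp
  then have indep:
    "indep_vars (\<lambda>_. borel) (\<lambda>p \<omega>. ?h p ((\<lambda>(k, i) \<omega>. d k \<omega> $ i) p \<omega>)) {(k, i), (k, m)}"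
    by (rule indep_vars_compose2) simp
  have f: "integrable M (\<lambda>\<omega>. f (d k \<omega> $ i))"
    using int(1) unfolding \<nu>[of i] by (rule integrable_distr[rotated]) measurable
  have g: "integrable M (\<lambda>\<omega>. g (d k \<omega> $ m))"
    using int(2) unfolding \<nu>[of m] by (rule integrable_distr[rotated]) measurable
  have integrable: "integrable M (\<lambda>\<omega>. ?h p ((\<lambda>(k, i) \<omega>. d k \<omega> $ i) p \<omega>))"
    if "p \<in> {(k, i), (k, m)}" for p
    using that f g \<open>i \<noteq> m\<close> by auto
  have "(LINT \<omega>|M. f (d k \<omega> $ i) * g (d k \<omega> $ m)) =
      (LINT \<omega>|M. f (d k \<omega> $ i)) * (LINT \<omega>|M. g (d k \<omega> $ m))"
    using indep_vars_lebesgue_integral[OF _ indep integrable] \<open>i \<noteq> m\<close> by simp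
  then show ?thesis
    using iid_components_expectation[OF iid] by simp
qed

section \<open>Matrix inverses and diagonal matrices\<close>

lemma matrix_inv_unique:
  fixes A B :: "'a::semiring_1^'n^'n"
  assumes "A ** B = mat 1" "B ** A = mat 1"
  shows "matrix_inv A = B"
proof -
  \<comment> \<open>\<open>matrix_inv\<close> is a choice among two-sided inverses, so the witness
    \<open>B\<close> ensures that the chosen matrix really is one.\<close>
  have inv: "A ** matrix_inv A = mat 1 \<and> matrix_inv A ** A = mat 1"
    unfolding matrix_inv_def
    by (rule someI[of "\<lambda>X. A ** X = mat 1 \<and> X ** A = mat 1" B]) (simp add: assms)
  then have "matrix_inv A = matrix_inv A ** (A ** B)"
    by (simp add: assms)
  also have "\<dots> = (matrix_inv A ** A) ** B"
    by (rule matrix_mul_assoc)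
  finally show ?thesis
    by (simp add: inv)
qed

lemma matrix_add_rdistrib:
  fixes A B :: "'a::semiring_1^'n^'m"
  shows "(A + B) ** C = A ** C + B ** C"
  by (simp add: matrix_matrix_mult_def vec_eq_iff sum.distrib distrib_right)

lemma transpose_diag [simp]: "transpose (diag v) = diag v"
  by (auto simp: transpose_def diag_def vec_eq_iff)

lemma diag_mult_diag: "diag v ** diag w = diag (\<lambda>i. v i * w i)"
  by (simp add: matrix_matrix_mult_def diag_def vec_eq_iff mult_delta_left)

lemma diag_one: "diag (\<lambda>_. 1) = mat 1"
  by (simp add: diag_def mat_def)

section \<open>Spectral form of the shifted Hessian\<close>

context sa_problem
begin

text \<open>Since \<open>P ** transpose P\<close> is the identity, subtracting a multiple of the
  identity keeps the eigenvectors and only shifts the eigenvalues.\<close>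

lemma shifted_hessian_decomposition:
  "shifted_hessian L \<theta>opt a \<alpha> \<gamma> = P ** diag (\<lambda>i. eig i - \<beta>_plus \<alpha> \<gamma> / 2) ** transpose P"
proof -
  let ?b = "\<beta>_plus \<alpha> \<gamma> / 2"
  have PP: "P ** transpose P = mat 1"
    using P_orthogonal by (simp add: orthogonal_matrix_def)
  have "a *\<^sub>R hessian L \<theta>opt = (P ** transpose P) ** (a *\<^sub>R hessian L \<theta>opt) ** (P ** transpose P)"
    by (simp add: PP)
  also have "\<dots> = P ** diag eig ** transpose P"
    by (simp only: eigenvalues[symmetric] matrix_mul_assoc)
  finally have H: "a *\<^sub>R hessian L \<theta>opt = P ** diag eig ** transpose P" .
  have "diag eig = diag (\<lambda>i. eig i - ?b) + ?b *\<^sub>R mat 1"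
    by (simp add: diag_def mat_def vec_eq_iff)
  then have "P ** diag eig ** transpose P =
      P ** diag (\<lambda>i. eig i - ?b) ** transpose P + ?b *\<^sub>R (P ** transpose P)"
    by (simp add: matrix_add_ldistrib matrix_add_rdistrib matrix_scalar_ac scalar_matrix_assoc)
  then show ?thesis
    by (simp add: shifted_hessian_def H PP)
qed

text \<open>For \<alpha> = 1 this is the bound on \<beta>; for \<alpha> < 1 the shift is zero. It
  makes the shifted Hessian invertible.\<close>

lemma shifted_eigenvalue_pos: "0 < eig i - \<beta>_plus \<alpha> \<gamma> / 2"
  using eig_pos[of i] \<beta>_less[of i] by (cases "\<alpha> = 1") (simp_all add: \<beta>_plus_def)

text \<open>In the eigenbasis the inverse is the diagonal matrix of reciprocal eigenvalues, and
  conjugating a diagonal matrix by the orthogonal \<open>P\<close> gives a symmetric matrix.\<close>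

lemma transpose_matrix_inv_shifted_hessian:
  "transpose (matrix_inv (shifted_hessian L \<theta>opt a \<alpha> \<gamma>)) =
    matrix_inv (shifted_hessian L \<theta>opt a \<alpha> \<gamma>)"
proof -
  define e where "e i = eig i - \<beta>_plus \<alpha> \<gamma> / 2" for i
  let ?B = "P ** diag (\<lambda>i. 1 / e i) ** transpose P"
  have P: "P ** transpose P = mat 1" "transpose P ** P = mat 1"
    using P_orthogonal by (simp_all add: orthogonal_matrix_def)
  \<comment> \<open>Conjugation by \<open>P\<close> is multiplicative, so both inverse identities
    reduce to products of diagonal matrices.\<close>
  have conj: "(P ** X ** transpose P) ** (P ** Y ** transpose P) = P ** (X ** Y) ** transpose P"
    for X Y :: "real^'p^'p"
  proof -
    have "(P ** X ** transpose P) ** (P ** Y ** transpose P) =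
        P ** X ** (transpose P ** P) ** Y ** transpose P"
      by (simp only: matrix_mul_assoc)
    then show ?thesis
      by (simp only: P matrix_mul_rid matrix_mul_assoc)
  qed
  have ne: "e i \<noteq> 0" for i
    using shifted_eigenvalue_pos[of i] by (simp add: e_def)
  have "(P ** diag (\<lambda>i. e i) ** transpose P) ** ?B = mat 1"
    "?B ** (P ** diag (\<lambda>i. e i) ** transpose P) = mat 1"
    unfolding conj diag_mult_diag by (simp_all add: ne diag_one P)
  then have "matrix_inv (shifted_hessian L \<theta>opt a \<alpha> \<gamma>) = ?B"
    unfolding shifted_hessian_decomposition e_def[symmetric] by (rule matrix_inv_unique)
  moreover have "transpose ?B = ?B"
    by (simp only: matrix_transpose_mul transpose_diag transpose_transpose matrix_mul_assoc)
  ultimately show ?thesis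
    by (simp only:)
qed

text \<open>\<open>S_matrix\<close> is the square of a symmetric inverse, one factor of which can
  move to the left argument. This turns the form given by \<open>S\<close> into inner products of
  bias vectors.\<close>

lemma inner_S_matrix:
  "x \<bullet> (S_matrix L \<theta>opt a \<alpha> \<gamma> *v y) =
    (matrix_inv (shifted_hessian L \<theta>opt a \<alpha> \<gamma>) *v x) \<bullet>
    (matrix_inv (shifted_hessian L \<theta>opt a \<alpha> \<gamma>) *v y)"
proof -
  let ?B = "matrix_inv (shifted_hessian L \<theta>opt a \<alpha> \<gamma>)"
  have "x v* ?B = ?B *v x"
    using vector_transpose_matrix[of x ?B] by (simp add: transpose_matrix_inv_shifted_hessian)
  then show ?thesis
    using dot_lmul_matrix[of x ?B "?B *v y"] by (simp add: S_matrix_def matrix_vector_mul_assoc)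
qed

end

text \<open>Strictness is characterised rather than asserted: the two errors coincide if 3 *
  \<gamma> - \<alpha> / 2 > 0, and also if \<open>condition\<close> holds with equality.\<close>

theorem proposition3:
  fixes L :: "real^'p::finite \<Rightarrow> real" and \<theta>opt :: "real^'p"
    and a c \<alpha> \<gamma> \<sigma> :: real and P :: "real^'p^'p" and eig :: "'p \<Rightarrow> real"
    and M_SP :: "'v measure" and \<theta>_SP \<Delta> :: "nat \<Rightarrow> 'v \<Rightarrow> real^'p"
    and \<epsilon>p_SP \<epsilon>m_SP :: "nat \<Rightarrow> 'v \<Rightarrow> real"
    and M_RD :: "'w measure" and \<theta>_RD \<pi> :: "nat \<Rightarrow> 'w \<Rightarrow> real^'p"
    and \<epsilon>p_RD \<epsilon>m_RD :: "nat \<Rightarrow> 'w \<Rightarrow> real"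
    and \<xi> \<rho> \<phi> \<upsilon> MSE_SP MSE_RD :: real
    and u1 u2 \<mu>_SP \<mu>_RD :: "real^'p" and S C_SP C_RD :: "real^'p^'p"
  assumes problem: "sa_problem L \<theta>opt a c \<alpha> \<gamma> P eig"
    and spsa: "sa_run M_SP spsa_estimate L a c \<alpha> \<gamma> \<theta>_SP \<Delta> \<epsilon>p_SP \<epsilon>m_SP \<sigma>"
    and rdsa: "sa_run M_RD rdsa_estimate L a c \<alpha> \<gamma> \<theta>_RD \<pi> \<epsilon>p_RD \<epsilon>m_RD \<sigma>"
    and bernoulli: "iid_components M_SP \<Delta> symmetric_bernoulli"
    and gaussian: "iid_components M_RD \<pi> std_normal_distribution"
    and \<xi>: "\<And>k i. \<xi>\<^sup>2 = (LINT \<omega>|M_SP. (\<Delta> k \<omega> $ i)\<^sup>2)"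
    and \<rho>: "\<And>k i. \<rho>\<^sup>2 = (LINT \<omega>|M_SP. 1 / (\<Delta> k \<omega> $ i)\<^sup>2)"
    and \<phi>: "\<And>k i. \<phi> = (LINT \<omega>|M_RD. (\<pi> k \<omega> $ i) ^ 4)"
    and \<upsilon>: "\<And>k i m. i \<noteq> m \<Longrightarrow> \<upsilon> = (LINT \<omega>|M_RD. (\<pi> k \<omega> $ i)\<^sup>2 * (\<pi> k \<omega> $ m)\<^sup>2)"
    and u1: "u1 = u_pure L \<theta>opt a c"
    and u2: "u2 = u_mixed L \<theta>opt a c"
    and S: "S = S_matrix L \<theta>opt a \<alpha> \<gamma>"
    and \<mu>_SP: "\<mu>_SP = asymptotic_mean L \<theta>opt a \<alpha> \<gamma> (spsa_T L \<theta>opt a c \<xi>)"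
    and \<mu>_RD: "\<mu>_RD = asymptotic_mean L \<theta>opt a \<alpha> \<gamma> (rdsa_T L \<theta>opt a c \<phi> \<upsilon>)"
    and C_SP: "C_SP = \<rho>\<^sup>2 *\<^sub>R M_matrix a c \<alpha> \<gamma> \<sigma> eig"
    and C_RD: "C_RD = M_matrix a c \<alpha> \<gamma> \<sigma> eig"
    and normal_SP: "asymptotically_normal M_SP (scaled_error (\<beta>_of \<alpha> \<gamma>) \<theta>opt \<theta>_SP)
      \<mu>_SP (P ** C_SP ** transpose P)"
    and normal_RD: "asymptotically_normal M_RD (scaled_error (\<beta>_of \<alpha> \<gamma>) \<theta>opt \<theta>_RD)
      \<mu>_RD (P ** C_RD ** transpose P)"
    and MSE_SP: "MSE_SP = asymptotic_mse \<mu>_SP C_SP"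
    and MSE_RD: "MSE_RD = asymptotic_mse \<mu>_RD C_RD"
    and condition: "2 * (u1 \<bullet> (S *v u1)) + u1 \<bullet> (S *v u2) \<ge> 0"
  shows "MSE_SP \<le> MSE_RD \<and>
    (MSE_SP < MSE_RD \<longleftrightarrow>
       3 * \<gamma> - \<alpha> / 2 = 0 \<and> 2 * (u1 \<bullet> (S *v u1)) + u1 \<bullet> (S *v u2) > 0)"
proof -
  interpret sa_problem L \<theta>opt a c \<alpha> \<gamma> P eig by fact
  interpret SP: sa_run M_SP spsa_estimate L a c \<alpha> \<gamma> \<theta>_SP \<Delta> \<epsilon>p_SP \<epsilon>m_SP \<sigma> by fact
  interpret RD: sa_run M_RD rdsa_estimate L a c \<alpha> \<gamma> \<theta>_RD \<pi> \<epsilon>p_RD \<epsilon>m_RD \<sigma> by fact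
  \<comment> \<open>The moments are the same for every iteration and coordinate, so iteration 0 and
    the arbitrary coordinate \<open>undefined\<close> suffice.\<close>
  have \<xi>1: "\<xi>\<^sup>2 = 1"
    using \<xi>[of 0 undefined]
      iid_components_expectation[OF bernoulli SP.d_measurable, of "\<lambda>x. x\<^sup>2" 0 undefined]
    by (simp add: integral_symmetric_bernoulli)
  have \<rho>1: "\<rho>\<^sup>2 = 1"
    using \<rho>[of 0 undefined]
      iid_components_expectation[OF bernoulli SP.d_measurable, of "\<lambda>x. 1 / x\<^sup>2" 0 undefined]
    by (simp add: integral_symmetric_bernoulli)
  \<comment> \<open>The standard normal moment of order 2n is (2n)! / (2^n n!), which is 24 / 8 for
    n = 2.\<close>
  have \<phi>3: "\<phi> = 3"
    using \<phi>[of 0 undefined] std_normal_distribution_even_moments(1)[of 2]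
      iid_components_expectation[OF gaussian RD.d_measurable, of "\<lambda>x. x ^ 4" 0 undefined]
    by (simp add: fact_numeral)
  text \<open>In dimension one \<open>\<upsilon>\<close> is unconstrained, but then \<open>u2\<close> is an empty sum.\<close>
  have \<upsilon>u2: "\<upsilon> *\<^sub>R u2 = u2"
  proof (cases "\<exists>i m :: 'p. i \<noteq> m")
    case True
    then obtain i m :: 'p where "i \<noteq> m" by blast
    \<comment> \<open>By independence \<upsilon> is a product of two unit variances; the moment fact
      for order 2 also supplies integrability.\<close>
    then have "\<upsilon> = 1"
      using \<upsilon>[of i m 0] std_normal_distribution_even_moments[of 1]
        iid_components_expectation_mult[OF RD.prob_space_axioms gaussian RD.d_measurable,
          of "\<lambda>x. x\<^sup>2" "\<lambda>x. x\<^sup>2" i m 0]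
      by simp
    then show ?thesis by simp
  next
    case False
    then have "UNIV - {l} = {}" for l :: 'p by blast
    then have "u2 = 0"
      by (simp only: u2 u_mixed_def sum.empty) (simp add: vec_eq_iff)
    then show ?thesis by simp
  qed
  let ?B = "matrix_inv (shifted_hessian L \<theta>opt a \<alpha> \<gamma>)"
  have diff: "MSE_RD - MSE_SP = \<mu>_RD \<bullet> \<mu>_RD - \<mu>_SP \<bullet> \<mu>_SP"
    by (simp add: MSE_RD MSE_SP asymptotic_mse_def C_RD C_SP \<rho>1)
  show ?thesis
  proof (cases "3 * \<gamma> - \<alpha> / 2 > 0")
    case True
    then show ?thesis
      using diff by (simp add: \<mu>_RD \<mu>_SP asymptotic_mean_def)
  next
    case False
    \<comment> \<open>The bound \<gamma> \<ge> \<alpha> / 6 excludes negative values, so only the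
      boundary case remains.\<close>
    with \<gamma>_ge have eq0: "3 * \<gamma> - \<alpha> / 2 = 0" by simp
    define v1 v2 where "v1 = ?B *v u1" and "v2 = ?B *v u2"
    have "spsa_T L \<theta>opt a c \<xi> = - (u1 + u2)"
      by (simp add: spsa_T_def \<xi>1 u1 u2)
    then have mSP: "\<mu>_SP = - (v1 + v2)"
      using False by (simp add: \<mu>_SP asymptotic_mean_def v1_def v2_def vec.neg
          matrix_vector_right_distrib del: minus_add_distrib)
    have "rdsa_T L \<theta>opt a c \<phi> \<upsilon> = - (3 *\<^sub>R u1 + u2)"
      using \<upsilon>u2 by (simp add: rdsa_T_def \<phi>3 u1 u2)
    then have mRD: "\<mu>_RD = - (3 *\<^sub>R v1 + v2)"
      using False by (simp add: \<mu>_RD asymptotic_mean_def v1_def v2_def vec.neg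
          matrix_vector_right_distrib matrix_vector_mult_scaleR del: minus_add_distrib)
    \<comment> \<open>Expanding |3 v1 + v2|^2 - |v1 + v2|^2 cancels the \<open>v2\<close> squares
      and leaves 8 |v1|^2 plus 4 times the inner product of \<open>v1\<close> and
      \<open>v2\<close>.\<close>
    have "MSE_RD - MSE_SP = 4 * (2 * (v1 \<bullet> v1) + v1 \<bullet> v2)"
      unfolding diff mSP mRD by (simp add: inner_commute algebra_simps)
    also have "2 * (v1 \<bullet> v1) + v1 \<bullet> v2 = 2 * (u1 \<bullet> (S *v u1)) + u1 \<bullet> (S *v u2)"
      by (simp add: S inner_S_matrix v1_def v2_def)
    finally show ?thesis
      using condition eq0 by auto
  qed
qed

end
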